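(* Let $\tilde A = \widehat A+\epsilon_2\widehat A_0 = A_0+\epsilon_1A_1+\epsilon_2A_2+\epsilon_1\epsilon_2A_3$ be an $n\times n$ hyper-dual matrix and $\tilde b\in \tilde{\mathbb{R}}^n$. Suppose that $\tilde A^{\#}$ exists with $\widehat A^{\#} = A_0^{\#}-\epsilon_1A_0^{\#}A_1A_0^{\#}$ and $\tilde A^{\#} = \widehat A^{\#}-\epsilon_2\widehat A^{\#}\widehat A_0\widehat A^{\#}$. Let $P\in\mathbb{R}^{n\times n}$ be a nonsingular matrix such that $P^{-1}\tilde A P=\begin{bmatrix}\tilde C&0\\0&0\end{bmatrix}$ with $\tilde C=C_0+\epsilon_1C_1+\epsilon_2C_2+\epsilon_1\epsilon_2C_3$ a nonsingular hyper-dual matrix. Then $\tilde x^*\in\tilde{\mathbb{R}}^n$ is a $P$-norm least-squares solution of $\tilde A\tilde x=\tilde b$ if and only if $\tilde x^*$ satisfies the group normal equation $\tilde A^2\tilde x^*=\tilde A\tilde b$. Moreover, $\tilde A^\#\tilde b$ is the unique minimal $P$-norm solution of the group normal equation, i.e. the unique element of smallest $P$-norm among all solutions $\tilde x\in\tilde{\mathbb{R}}^n$ of $\tilde A^2\tilde x=\tilde A\tilde b$.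
   Context: Hyper-dual numbers are elements $a_0+\epsilon_1a_1+\epsilon_2a_2+\epsilon_1\epsilon_2a_3$ with $a_i\in\mathbb{R}$, where $\epsilon_1,\epsilon_2$ commute, $\epsilon_1^2=\epsilon_2^2=0$ and $\epsilon_1\epsilon_2\ne0$ (i.e. the commutative ring $\mathbb{R}[\epsilon_1,\epsilon_2]/(\epsilon_1^2,\epsilon_2^2)$). An $n\times n$ hyper-dual matrix is $\tilde A=\widehat A+\epsilon_2\widehat A_0$ with $\widehat A=A_0+\epsilon_1A_1$, $\widehat A_0=A_2+\epsilon_1A_3$ dual matrices, $A_i\in\mathbb{R}^{n\times n}$. $\tilde{\mathbb{R}}^n$ is the set of $n$-dimensional hyper-dual column vectors. The group inverse of a square matrix $M$ (real, dual or hyper-dual) is the (unique, if it exists) matrix $G=M^{\#}$ of the same type with $MGM=M$, $GMG=G$, $MG=GM$. For a nonsingular real matrix $P$, the $P$-norm of $\tilde{x}=u_{0}+\epsilon_1 u_{1}+ \epsilon_2 v_{2}+\epsilon_1 \epsilon_2v_{3}\in\tilde{\mathbb{R}}^n$ ($u_0,u_1,v_2,v_3\in\mathbb{R}^n$) is $$\|\tilde{x}\|_{P}=\sqrt{\|P^{-1}u_{0}\|_{2}^2+\|P^{-1}u_{1}\|_{2}^2+\|P^{-1}v_{2}\|_{2}^2+\|P^{-1}v_{3}\|_{2}^2}.$$ $\tilde x^*$ is a $P$-norm least-squares solution of $\tilde A\tilde x=\tilde b$ if $\|\tilde A\tilde x^*-\tilde b\|_P\le\|\tilde A\tilde x-\tilde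 b\|_P$ for all $\tilde x\in\tilde{\mathbb{R}}^n$. *)

theory Defs
  imports Complex_Main
    "Jordan_Normal_Form.Matrix"
    "Jordan_Normal_Form.Gauss_Jordan_Elimination"
begin

text \<open>
  \<open>Dual a b\<close> stands for \<open>a + \<epsilon> b\<close> with \<open>\<epsilon>\<^sup>2 = 0\<close>. The construction works over any commutative ring,
  so that it can be iterated: the hyper-dual numbers
  \<open>\<real>[\<epsilon>\<^sub>1,\<epsilon>\<^sub>2]/(\<epsilon>\<^sub>1\<^sup>2,\<epsilon>\<^sub>2\<^sup>2)\<close> are the dual numbers in \<open>\<epsilon>\<^sub>2\<close> over the real dual numbers in \<open>\<epsilon>\<^sub>1\<close>.
\<close>

datatype 'a dual = Dual (std: 'a) (inf_part: 'a)

instantiation dual :: (comm_ring_1) comm_ring_1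
begin

definition "0 = Dual 0 0"
definition "1 = Dual 1 0"
definition "x + y = Dual (std x + std y) (inf_part x + inf_part y)"
definition "x - y = Dual (std x - std y) (inf_part x - inf_part y)"
definition "- x = Dual (- std x) (- inf_part x)"
definition "x * y = Dual (std x * std y) (std x * inf_part y + inf_part x * std y)"

instance
  by standard
    (auto simp: zero_dual_def one_dual_def plus_dual_def minus_dual_def uminus_dual_def
      times_dual_def algebra_simps)

end

definition eps :: "'a::comm_ring_1 dual" where
  "eps = Dual 0 1"

definition of_std :: "'a::comm_ring_1 \<Rightarrow> 'a dual" where
  "of_std a = Dual a 0"

lemmas dual_defs = zero_dual_def one_dual_def plus_dual_def minus_dual_def uminus_dual_def
  times_dual_def eps_def of_std_def

lemma Dual_eq: "Dual a b = of_std a + eps * of_std b"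
  by (simp add: dual_defs)

lemma eps_square: "eps * eps = (0 :: 'a::comm_ring_1 dual)"
  by (simp add: dual_defs)

type_synonym hyperdual = "real dual dual"

definition eps1 :: hyperdual where
  "eps1 = of_std eps"

definition eps2 :: hyperdual where
  "eps2 = eps"

definition hd_of_real :: "real \<Rightarrow> hyperdual" where
  "hd_of_real a = of_std (of_std a)"

lemma hyperdual_units:
  "eps1 * eps1 = 0" "eps2 * eps2 = 0" "eps1 * eps2 \<noteq> 0"
  by (simp_all add: eps1_def eps2_def dual_defs)

lemma hyperdual_expansion:
  "Dual (Dual a0 a1) (Dual a2 a3) =
    hd_of_real a0 + eps1 * hd_of_real a1 + eps2 * hd_of_real a2 + eps1 * eps2 * hd_of_real a3"
  by (simp add: eps1_def eps2_def hd_of_real_def dual_defs)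

text \<open>\<open>dual_mat M N\<close> is \<open>M + \<epsilon> N\<close>; applied to dual matrices it is \<open>M + \<epsilon>\<^sub>2 N\<close>.\<close>

definition dual_mat :: "'a::comm_ring_1 mat \<Rightarrow> 'a mat \<Rightarrow> 'a dual mat" where
  "dual_mat M N = map_mat of_std M + eps \<cdot>\<^sub>m map_mat of_std N"

definition hyperdual_mat :: "real mat \<Rightarrow> real mat \<Rightarrow> real mat \<Rightarrow> real mat \<Rightarrow> hyperdual mat" where
  "hyperdual_mat M0 M1 M2 M3 = dual_mat (dual_mat M0 M1) (dual_mat M2 M3)"

lemma hyperdual_mat_expansion:
  assumes "M0 \<in> carrier_mat n m" "M1 \<in> carrier_mat n m" "M2 \<in> carrier_mat n m" "M3 \<in> carrier_mat n m"
  shows "hyperdual_mat M0 M1 M2 M3 =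
    map_mat hd_of_real M0 + eps1 \<cdot>\<^sub>m map_mat hd_of_real M1
      + eps2 \<cdot>\<^sub>m map_mat hd_of_real M2 + (eps1 * eps2) \<cdot>\<^sub>m map_mat hd_of_real M3"
  using assms unfolding hyperdual_mat_def dual_mat_def
  by (intro eq_matI) (auto simp: eps1_def eps2_def hd_of_real_def dual_defs)

definition is_group_inverse :: "'a::comm_ring_1 mat \<Rightarrow> 'a mat \<Rightarrow> bool" where
  "is_group_inverse M G \<longleftrightarrow>
    square_mat M \<and> G \<in> carrier_mat (dim_row M) (dim_row M) \<and>
    M * G * M = M \<and> G * M * G = G \<and> M * G = G * M"

definition group_invertible :: "'a::comm_ring_1 mat \<Rightarrow> bool" where
  "group_invertible M \<longleftrightarrow> (\<exists>G. is_group_inverse M G)"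

definition group_inverse :: "'a::comm_ring_1 mat \<Rightarrow> 'a mat"  (\<open>_\<^sup>#\<close> [1000] 999) where
  "M\<^sup># = (THE G. is_group_inverse M G)"

lemma is_group_inverse_unique:
  assumes "is_group_inverse M G" "is_group_inverse M H"
  shows "G = H"
proof -
  define n where "n = dim_row M"
  have c: "M \<in> carrier_mat n n" "G \<in> carrier_mat n n" "H \<in> carrier_mat n n"
    and g: "M * G * M = M" "G * M * G = G" "M * G = G * M"
    and h: "M * H * M = M" "H * M * H = H" "M * H = H * M"
    using assms unfolding is_group_inverse_def n_def square_mat.simps carrier_mat_def by blast+
  note a = assoc_mult_mat[of _ n n _ n _ n]
  have "G * M = G * (M * H * M)" by (simp only: h(1))
  also have "\<dots> = (G * M) * (H * M)" using c by (simp add: a)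
  also have "\<dots> = (M * G) * (M * H)" by (simp only: g(3) h(3))
  also have "\<dots> = M * G * M * H" using c by (simp add: a)
  also have "\<dots> = M * H" by (simp only: g(1))
  finally have e: "G * M = M * H" .
  have "G = G * M * G" by (simp only: g(2))
  also have "\<dots> = H * M * G" by (simp only: e h(3))
  also have "\<dots> = H * (M * G)" using c by (simp add: a)
  also have "\<dots> = H * (M * H)" by (simp only: g(3) e)
  also have "\<dots> = H * M * H" using c by (simp add: a)
  also have "\<dots> = H" by (rule h(2))
  finally show ?thesis .
qed

lemma group_inverse_works:
  assumes "group_invertible M"
  shows "is_group_inverse M (M\<^sup>#)"
proof -
  from assms obtain G where G: "is_group_inverse M G"
    unfolding group_invertible_def by blast
  then show ?thesis
    unfolding group_inverse_def by (rule theI) (rule is_group_inverse_unique[OF _ G])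
qed

text \<open>\<^const>\<open>mat_inverse\<close> returns an option; the value below is only meaningful for invertible
  matrices.\<close>

definition mat_inv :: "real mat \<Rightarrow> real mat" where
  "mat_inv P = the (mat_inverse P)"

lemma mat_inv_works:
  assumes P: "P \<in> carrier_mat n n" and inv: "invertible_mat P"
  shows "mat_inv P \<in> carrier_mat n n" "P * mat_inv P = 1\<^sub>m n" "mat_inv P * P = 1\<^sub>m n"
proof -
  from inv obtain B where B: "P * B = 1\<^sub>m (dim_row P)" "B * P = 1\<^sub>m (dim_row B)"
    unfolding invertible_mat_def inverts_mat_def by blast
  have "dim_col B = n" using arg_cong[OF B(1), of dim_col] P by simp
  moreover have "dim_row B = n" using arg_cong[OF B(2), of dim_col] P by simp
  ultimately have "B \<in> carrier_mat n n" by auto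
  with P B have "P \<in> Units (ring_mat TYPE(real) n ())"
    unfolding Units_def ring_mat_def by auto
  with mat_inverse(1)[OF P, where b = "()"] obtain Q where Q: "mat_inverse P = Some Q"
    by (cases "mat_inverse P") auto
  from mat_inverse(2)[OF P Q] Q
  show "mat_inv P \<in> carrier_mat n n" "P * mat_inv P = 1\<^sub>m n" "mat_inv P * P = 1\<^sub>m n"
    by (simp_all add: mat_inv_def)
qed

definition norm2 :: "real vec \<Rightarrow> real" where
  "norm2 v = sqrt (v \<bullet> v)"

text \<open>For \<open>x = u\<^sub>0 + \<epsilon>\<^sub>1 u\<^sub>1 + \<epsilon>\<^sub>2 v\<^sub>2 + \<epsilon>\<^sub>1\<epsilon>\<^sub>2 v\<^sub>3\<close> the four vectors below are
  \<open>u\<^sub>0, u\<^sub>1, v\<^sub>2, v\<^sub>3\<close> in this order.\<close>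

definition pnorm :: "real mat \<Rightarrow> hyperdual vec \<Rightarrow> real" where
  "pnorm P x = sqrt (
      (norm2 (mat_inv P *\<^sub>v map_vec (\<lambda>z. std (std z)) x))\<^sup>2
    + (norm2 (mat_inv P *\<^sub>v map_vec (\<lambda>z. inf_part (std z)) x))\<^sup>2
    + (norm2 (mat_inv P *\<^sub>v map_vec (\<lambda>z. std (inf_part z)) x))\<^sup>2
    + (norm2 (mat_inv P *\<^sub>v map_vec (\<lambda>z. inf_part (inf_part z)) x))\<^sup>2)"

definition is_pnorm_least_squares ::
    "real mat \<Rightarrow> hyperdual mat \<Rightarrow> hyperdual vec \<Rightarrow> hyperdual vec \<Rightarrow> bool" where
  "is_pnorm_least_squares P A b x \<longleftrightarrow>
    x \<in> carrier_vec (dim_col A) \<and>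
    (\<forall>y \<in> carrier_vec (dim_col A). pnorm P (A *\<^sub>v x - b) \<le> pnorm P (A *\<^sub>v y - b))"

definition is_minimal_pnorm ::
    "real mat \<Rightarrow> hyperdual vec set \<Rightarrow> hyperdual vec \<Rightarrow> bool" where
  "is_minimal_pnorm P S x \<longleftrightarrow> x \<in> S \<and> (\<forall>y \<in> S. pnorm P x \<le> pnorm P y)"

end

theory Submission
  imports Defs
begin

text \<open>
  In the coordinates \<open>y = P\<^sup>-\<^sup>1 x\<close>, \<open>c = P\<^sup>-\<^sup>1 b\<close>, the \<open>P\<close>-norm becomes the sum over the entries of the definite weight
  \<open>a\<^sub>0\<^sup>2 + a\<^sub>1\<^sup>2 + a\<^sub>2\<^sup>2 + a\<^sub>3\<^sup>2\<close>, and \<open>A\<close> becomes \<open>D = diag(C, 0)\<close>. With \<open>E = diag(C\<^sup>-\<^sup>1, 0)\<close> and the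
  coordinate projection \<open>F = D E = E D\<close>, the residual \<open>D y - c\<close> splits into \<open>D y - F c\<close>, which can be
  made zero, and the constant \<open>F c - c\<close>. Hence least-squares solutions are those with \<open>D y = F c\<close>,
  equivalently \<open>D\<^sup>2 y = D c\<close>; among them \<open>y = E c\<close> is the one whose remaining entries vanish. The group
  inverse solution is this one because it solves the normal equation and \<open>A\<^sup># b\<close> lies in the range of \<open>A\<close>.
\<close>

section \<open>Coordinate projections and corner block matrices\<close>

definition coord_proj :: "nat \<Rightarrow> nat \<Rightarrow> 'a::comm_ring_1 mat" where
  "coord_proj n r = mat n n (\<lambda>(i, j). if i = j \<and> i < r then 1 else 0)"

lemma coord_proj_carrier [simp]: "coord_proj n r \<in> carrier_mat n n"
  by (simp add: coord_proj_def)

lemma index_coord_proj_mult_vec: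
  assumes "v \<in> carrier_vec n" "i < n"
  shows "(coord_proj n r *\<^sub>v v) $ i = (if i < r then v $ i else 0)"
proof -
  have "(coord_proj n r *\<^sub>v v) $ i = (\<Sum>j<n. (if i = j \<and> i < r then 1 else 0) * v $ j)"
    using assms by (simp add: coord_proj_def scalar_prod_def atLeast0LessThan)
  also have "\<dots> = (\<Sum>j<n. if j = i then (if i < r then v $ i else 0) else 0)"
    by (rule sum.cong) auto
  finally show ?thesis using assms by simp
qed

abbreviation corner_mat :: "nat \<Rightarrow> nat \<Rightarrow> 'a::comm_ring_1 mat \<Rightarrow> 'a mat" where
  "corner_mat n r C \<equiv>
    four_block_mat C (0\<^sub>m r (n - r)) (0\<^sub>m (n - r) r) (0\<^sub>m (n - r) (n - r))"

lemma corner_mat_carrier: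
  assumes "r \<le> n" "C \<in> carrier_mat r r"
  shows "corner_mat n r C \<in> carrier_mat n n"
  using four_block_carrier_mat[OF assms(2), of "0\<^sub>m (n - r) (n - r)" "n - r" "n - r"] assms(1)
  by simp

text \<open>The zero blocks annihilate every cross term of the block product. With
  \<open>corner_mat_one\<close>, this reduces all identities between \<open>D\<close>,
  \<open>E\<close> and the projection to \<open>C * B = 1\<close> and
  \<open>B * C = 1\<close>.\<close>

lemma corner_mat_mult:
  assumes "C \<in> carrier_mat r r" "B \<in> carrier_mat r r"
  shows "corner_mat n r C * corner_mat n r B = corner_mat n r (C * B)"
  using assms by (subst mult_four_block_mat[of _ r r _ "n - r" _ "n - r" _ _ r _ "n - r"]) auto

lemma corner_mat_one:
  assumes "r \<le> n"
  shows "corner_mat n r (1\<^sub>m r) = coord_proj n r"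
  using assms by (intro eq_matI) (auto simp: coord_proj_def)

text \<open>\<open>invertible_mat\<close> does not state the size of the inverse; comparing column
  counts in the two product equations recovers it.\<close>

lemma invertible_matE:
  assumes "invertible_mat C" "C \<in> carrier_mat n n"
  obtains B where "B \<in> carrier_mat n n" "C * B = 1\<^sub>m n" "B * C = 1\<^sub>m n"
proof -
  from assms obtain B where B: "C * B = 1\<^sub>m n" "B * C = 1\<^sub>m (dim_row B)"
    unfolding invertible_mat_def inverts_mat_def by auto
  have "dim_col B = n" "dim_row B = n"
    using arg_cong[OF B(1), of dim_col] arg_cong[OF B(2), of dim_col] assms(2) by simp_all
  with B that show thesis by auto
qed

section \<open>Definite weights on vectors\<close>

locale definite_weight =
  fixes q :: "'a::comm_ring_1 \<Rightarrow> real"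
  assumes nonneg: "q z \<ge> 0"
    and eq_0_iff: "q z = 0 \<longleftrightarrow> z = 0"
    and minus: "q (- z) = q z"
begin

definition vec_weight :: "'a vec \<Rightarrow> real" where
  "vec_weight v = (\<Sum>i<dim_vec v. q (v $ i))"

lemma vec_weight_nonneg: "vec_weight v \<ge> 0"
  by (simp add: vec_weight_def nonneg sum_nonneg)

lemma vec_weight_eq_0_iff:
  assumes "v \<in> carrier_vec n"
  shows "vec_weight v = 0 \<longleftrightarrow> v = 0\<^sub>v n"
  using assms by (auto simp: vec_weight_def nonneg eq_0_iff sum_nonneg_eq_0_iff)

text \<open>A Pythagorean identity for disjoint supports: at each index one of the two entries is 0,
  where \<open>q\<close> vanishes, and evenness of \<open>q\<close> removes the sign of the
  other.\<close>

lemma vec_weight_add_disjoint: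
  assumes "u \<in> carrier_vec n" "v \<in> carrier_vec n"
    and "\<And>i. i < n \<Longrightarrow> u $ i = 0 \<or> v $ i = 0"
  shows "vec_weight (u - v) = vec_weight u + vec_weight v"
proof -
  have "q 0 = 0" by (simp add: eq_0_iff)
  with assms show ?thesis
    unfolding vec_weight_def
    by (fastforce simp: minus sum.distrib[symmetric] intro!: sum.cong)
qed

end

section \<open>Least squares and minimal solutions in block-diagonal coordinates\<close>

lemma minus_vec_eq_0_iff:
  fixes u v :: "'a::comm_ring_1 vec"
  assumes "u \<in> carrier_vec n" "v \<in> carrier_vec n"
  shows "u - v = 0\<^sub>v n \<longleftrightarrow> u = v"
  using assms by (auto simp: vec_eq_iff)

text \<open>The assumptions make \<open>E\<close> the group inverse of \<open>D\<close>, with the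
  coordinate projection as their common product; \<open>absorb\<close> says that both matrices live
  in the upper left corner.\<close>

locale corner_inverse_pair = definite_weight q
  for q :: "'a::comm_ring_1 \<Rightarrow> real" +
  fixes n r :: nat and D E :: "'a mat"
  assumes carrier: "D \<in> carrier_mat n n" "E \<in> carrier_mat n n"
    and products: "D * E = coord_proj n r" "E * D = coord_proj n r"
    and absorb: "coord_proj n r * D = D" "D * coord_proj n r = D"
      "coord_proj n r * E = E" "E * coord_proj n r = E"
begin

abbreviation F where "F \<equiv> coord_proj n r :: 'a mat"

lemma vec_products:
  assumes "v \<in> carrier_vec n"
  shows "D *\<^sub>v (E *\<^sub>v v) = F *\<^sub>v v" "E *\<^sub>v (D *\<^sub>v v) = F *\<^sub>v v"
    "F *\<^sub>v (D *\<^sub>v v) = D *\<^sub>v v" "D *\<^sub>v (F *\<^sub>v v) = D *\<^sub>v v"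
    "F *\<^sub>v (E *\<^sub>v v) = E *\<^sub>v v" "E *\<^sub>v (F *\<^sub>v v) = E *\<^sub>v v"
  using assms carrier
  by (simp_all add: assoc_mult_mat_vec[of _ n n _ n, symmetric] products absorb)

lemma carrier_vecs [simp]:
  assumes "v \<in> carrier_vec n"
  shows "D *\<^sub>v v \<in> carrier_vec n" "E *\<^sub>v v \<in> carrier_vec n" "F *\<^sub>v v \<in> carrier_vec n"
  using assms carrier by (simp_all add: mult_mat_vec_carrier[of _ n n])

text \<open>Applying \<open>E\<close> cancels one factor \<open>D\<close>, because
  \<open>E * D\<close> is the projection and fixes the range of \<open>D\<close>. Applying
  \<open>D\<close> goes back.\<close>

lemma normal_equation_iff:
  assumes "y \<in> carrier_vec n" "c \<in> carrier_vec n"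
  shows "D *\<^sub>v (D *\<^sub>v y) = D *\<^sub>v c \<longleftrightarrow> D *\<^sub>v y = F *\<^sub>v c"
proof
  assume "D *\<^sub>v (D *\<^sub>v y) = D *\<^sub>v c"
  then have "E *\<^sub>v (D *\<^sub>v (D *\<^sub>v y)) = E *\<^sub>v (D *\<^sub>v c)" by simp
  then show "D *\<^sub>v y = F *\<^sub>v c" using assms by (simp add: vec_products)
next
  assume "D *\<^sub>v y = F *\<^sub>v c"
  then show "D *\<^sub>v (D *\<^sub>v y) = D *\<^sub>v c" using assms by (simp add: vec_products)
qed

text \<open>\<open>E\<close> carries the left equation to the right one, and \<open>D\<close>
  carries it back. Thus the first \<open>r\<close> entries of a solution are determined and the
  others are free.\<close>

lemma projected_eq_iff:
  assumes "y \<in> carrier_vec n" "c \<in> carrier_vec n"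
  shows "D *\<^sub>v y = F *\<^sub>v c \<longleftrightarrow> F *\<^sub>v y = E *\<^sub>v c"
  using assms by (metis vec_products)

lemma index_range:
  assumes "y \<in> carrier_vec n" "i < n" "\<not> i < r"
  shows "(D *\<^sub>v y) $ i = 0"
  using index_coord_proj_mult_vec[of "D *\<^sub>v y" n i r] assms by (simp add: vec_products)

text \<open>The first summand is supported on indices below \<open>r\<close> and alone depends on
  \<open>y\<close>; the second is supported on the remaining indices.\<close>

lemma residual_split:
  assumes y: "y \<in> carrier_vec n" and c: "c \<in> carrier_vec n"
  shows "vec_weight (D *\<^sub>v y - c) = vec_weight (D *\<^sub>v y - F *\<^sub>v c) + vec_weight (c - F *\<^sub>v c)"
proof -
  have "D *\<^sub>v y - c = (D *\<^sub>v y - F *\<^sub>v c) - (c - F *\<^sub>v c)"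
    using carrier_vecs(1)[OF y] carrier_vecs(3)[OF c] c
    by (intro eq_vecI) (auto simp: carrier_matD(1)[OF coord_proj_carrier] simp del: index_mult_mat_vec carrier_vecs)
  also have "vec_weight \<dots> = vec_weight (D *\<^sub>v y - F *\<^sub>v c) + vec_weight (c - F *\<^sub>v c)"
    using y c carrier_vecs(1)[OF y] carrier_vecs(3)[OF c]
    by (intro vec_weight_add_disjoint[of _ n])
      (auto simp: carrier_matD(1)[OF coord_proj_carrier] index_coord_proj_mult_vec index_range
        simp del: index_mult_mat_vec carrier_vecs)
  finally show ?thesis .
qed

text \<open>The two vectors on the right have disjoint supports. The second is
  \<open>F *\<^sub>v y - y\<close> rather than its negative, so that \<open>y\<close> is a
  difference, as \<open>vec_weight_add_disjoint\<close> requires.\<close>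

lemma solution_split:
  assumes "y \<in> carrier_vec n"
  shows "vec_weight y = vec_weight (F *\<^sub>v y) + vec_weight (F *\<^sub>v y - y)"
proof -
  have "y = F *\<^sub>v y - (F *\<^sub>v y - y)"
    using assms by (intro eq_vecI) (auto simp: coord_proj_def)
  also have "vec_weight \<dots> = vec_weight (F *\<^sub>v y) + vec_weight (F *\<^sub>v y - y)"
    using assms carrier_vecs[OF assms]
    by (intro vec_weight_add_disjoint[of _ n])
      (auto simp: index_coord_proj_mult_vec simp del: index_mult_mat_vec)
  finally show ?thesis .
qed

lemma least_squares_iff:
  assumes y: "y \<in> carrier_vec n" and c: "c \<in> carrier_vec n"
  shows "(\<forall>z \<in> carrier_vec n. vec_weight (D *\<^sub>v y - c) \<le> vec_weight (D *\<^sub>v z - c))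
    \<longleftrightarrow> D *\<^sub>v y = F *\<^sub>v c" (is "?L \<longleftrightarrow> ?R")
proof -
  have zero: "vec_weight (D *\<^sub>v z - F *\<^sub>v c) = 0 \<longleftrightarrow> D *\<^sub>v z = F *\<^sub>v c" if "z \<in> carrier_vec n" for z
    using that c by (simp add: vec_weight_eq_0_iff[of _ n] minus_vec_eq_0_iff[of _ n])
  show ?thesis
  proof
    assume ?L
    \<comment> \<open>The competitor is \<open>E *\<^sub>v c\<close>, whose image under
      \<open>D\<close> is exactly \<open>F *\<^sub>v c\<close>; the constant part of the residual
      cancels on both sides.\<close>
    then have "vec_weight (D *\<^sub>v y - F *\<^sub>v c) \<le> vec_weight (D *\<^sub>v (E *\<^sub>v c) - F *\<^sub>v c)"
      using y c by (simp add: residual_split[OF _ c])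
    also have "\<dots> = 0" using c by (subst zero) (simp_all add: vec_products)
    finally show ?R using vec_weight_nonneg zero[OF y] by (simp add: order_antisym)
  next
    assume ?R
    then have "vec_weight (D *\<^sub>v y - c) = vec_weight (c - F *\<^sub>v c)"
      using residual_split[OF y c] zero[OF y] by simp
    then show ?L using residual_split[OF _ c] vec_weight_nonneg by fastforce
  qed
qed

text \<open>All solutions \<open>z\<close> share the projection
  \<open>F *\<^sub>v z = E *\<^sub>v c\<close>, so their weights differ only in the part outside the
  corner. That part vanishes exactly for \<open>E *\<^sub>v c\<close>, which is itself a
  solution.\<close>

lemma minimal_solution_iff:
  assumes y: "y \<in> carrier_vec n" and c: "c \<in> carrier_vec n"
  shows "D *\<^sub>v y = F *\<^sub>v c \<and>
      (\<forall>z \<in> carrier_vec n. D *\<^sub>v z = F *\<^sub>v c \<longrightarrow> vec_weight y \<le> vec_weight z)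
    \<longleftrightarrow> y = E *\<^sub>v c" (is "?L \<longleftrightarrow> ?R")
proof
  assume L: ?L
  then have Fy: "F *\<^sub>v y = E *\<^sub>v c" using y c projected_eq_iff by blast
  have "vec_weight y \<le> vec_weight (E *\<^sub>v c)" using L c by (simp add: vec_products)
  then have "vec_weight (F *\<^sub>v y - y) = 0"
    using solution_split[OF y] vec_weight_nonneg[of "F *\<^sub>v y - y"] Fy by simp
  then show ?R
    using y Fy by (simp add: vec_weight_eq_0_iff[of _ n] minus_vec_eq_0_iff[of _ n] c)
next
  assume R: ?R
  have "vec_weight y \<le> vec_weight z" if z: "z \<in> carrier_vec n" "D *\<^sub>v z = F *\<^sub>v c" for z
    using solution_split[OF z(1)] vec_weight_nonneg[of "F *\<^sub>v z - z"] z c R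
    by (simp add: projected_eq_iff)
  then show ?L using R c by (simp add: vec_products)
qed

end

section \<open>The \<open>P\<close>-norm as a weight in transformed coordinates\<close>

definition hd_weight :: "hyperdual \<Rightarrow> real" where
  "hd_weight z = (std (std z))\<^sup>2 + (inf_part (std z))\<^sup>2
    + (std (inf_part z))\<^sup>2 + (inf_part (inf_part z))\<^sup>2"

interpretation hd: definite_weight hd_weight
proof
  fix z :: hyperdual
  show "hd_weight z = 0 \<longleftrightarrow> z = 0"
    by (cases z; cases "std z"; cases "inf_part z")
      (auto simp: hd_weight_def dual_defs add_nonneg_eq_0_iff)
qed (simp_all add: hd_weight_def dual_defs)

lemma hd_of_real_mult_parts:
  "std (std (hd_of_real a * z)) = a * std (std z)"
  "inf_part (std (hd_of_real a * z)) = a * inf_part (std z)"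
  "std (inf_part (hd_of_real a * z)) = a * std (inf_part z)"
  "inf_part (inf_part (hd_of_real a * z)) = a * inf_part (inf_part z)"
  by (simp_all add: hd_of_real_def dual_defs)

text \<open>A real-linear \<open>f\<close> commutes with the finite sums defining a product with a
  real matrix. It is applied to the four part projections of a hyper-dual number.\<close>

lemma mult_mat_vec_map_hd:
  fixes f :: "hyperdual \<Rightarrow> real"
  assumes R: "R \<in> carrier_mat n n" and x: "x \<in> carrier_vec n"
    and f: "f 0 = 0" "\<And>y z. f (y + z) = f y + f z" "\<And>a z. f (hd_of_real a * z) = a * f z"
  shows "R *\<^sub>v map_vec f x = map_vec f (map_mat hd_of_real R *\<^sub>v x)"
proof -
  have "f (sum g S) = (\<Sum>i\<in>S. f (g i))" if "finite S" for g and S :: "nat set"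
    using that by induction (simp_all add: f)
  then show ?thesis
    using R x by (intro eq_vecI) (auto simp: scalar_prod_def f intro!: sum.cong)
qed

lemma norm2_map_vec: "(norm2 (map_vec f x))\<^sup>2 = (\<Sum>i<dim_vec x. (f (x $ i))\<^sup>2)"
  by (simp add: norm2_def scalar_prod_def sum_nonneg atLeast0LessThan power2_eq_square)

text \<open>The real matrix \<open>mat_inv P\<close> acts on each of the four parts separately, so
  it can be moved inside them; then the four sums of squares merge entrywise.\<close>

lemma pnorm_eq_vec_weight:
  assumes P: "mat_inv P \<in> carrier_mat n n" and x: "x \<in> carrier_vec n"
  shows "pnorm P x = sqrt (hd.vec_weight (map_mat hd_of_real (mat_inv P) *\<^sub>v x))"
  unfolding pnorm_def hd.vec_weight_def hd_weight_def
  by (subst (1 2 3 4) mult_mat_vec_map_hd[OF P x])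
    (simp_all add: hd_of_real_mult_parts norm2_map_vec sum.distrib,
     simp_all add: dual_defs)

lemma hd_of_real_hom:
  "hd_of_real 0 = 0" "hd_of_real 1 = 1"
  "hd_of_real (a + b) = hd_of_real a + hd_of_real b"
  "hd_of_real (a * b) = hd_of_real a * hd_of_real b"
  by (simp_all add: hd_of_real_def dual_defs)

lemma map_mat_hd_mult_eq_one:
  assumes P: "P \<in> carrier_mat n n" and R: "R \<in> carrier_mat n n" and one: "P * R = 1\<^sub>m n"
  shows "map_mat hd_of_real P * map_mat hd_of_real R = 1\<^sub>m n"
proof -
  interpret semiring_hom hd_of_real by unfold_locales (simp_all add: hd_of_real_hom)
  show ?thesis using mat_hom_mult[OF P R] one by (simp add: mat_hom_one)
qed

section \<open>Transport to the original coordinates\<close>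

lemma dual_mat_carrier:
  assumes "M \<in> carrier_mat n m" "N \<in> carrier_mat n m"
  shows "dual_mat M N \<in> carrier_mat n m"
  using assms by (simp add: dual_mat_def)

theorem theorem4p6:
  fixes n r :: nat
    and A0 A1 A2 A3 P C0 C1 C2 C3 :: "real mat"
    and Ah Ah0 :: "real dual mat"
    and A C :: "hyperdual mat"
    and b :: "hyperdual vec"
  assumes "A0 \<in> carrier_mat n n" "A1 \<in> carrier_mat n n"
    and "A2 \<in> carrier_mat n n" "A3 \<in> carrier_mat n n"
    and "Ah = dual_mat A0 A1" and "Ah0 = dual_mat A2 A3" and "A = dual_mat Ah Ah0"
    and "b \<in> carrier_vec n"
    and "group_invertible A0" and "group_invertible Ah" and "group_invertible A"
    and "Ah\<^sup># = dual_mat (A0\<^sup>#) (- (A0\<^sup># * A1 * A0\<^sup>#))"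
    and "A\<^sup># = dual_mat (Ah\<^sup>#) (- (Ah\<^sup># * Ah0 * Ah\<^sup>#))"
    and "P \<in> carrier_mat n n" and "invertible_mat P"
    and "r \<le> n"
    and "C0 \<in> carrier_mat r r" "C1 \<in> carrier_mat r r"
    and "C2 \<in> carrier_mat r r" "C3 \<in> carrier_mat r r"
    and "C = hyperdual_mat C0 C1 C2 C3" and "invertible_mat C"
    and "map_mat hd_of_real (mat_inv P) * A * map_mat hd_of_real P
        = four_block_mat C (0\<^sub>m r (n - r)) (0\<^sub>m (n - r) r) (0\<^sub>m (n - r) (n - r))"
  shows "(\<forall>x \<in> carrier_vec n. is_pnorm_least_squares P A b x \<longleftrightarrow> (A ^\<^sub>m 2) *\<^sub>v x = A *\<^sub>v b)
    \<and> (\<forall>x. is_minimal_pnorm P {y \<in> carrier_vec n. (A ^\<^sub>m 2) *\<^sub>v y = A *\<^sub>v b} x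
            \<longleftrightarrow> x = A\<^sup># *\<^sub>v b)"
proof -
  define Q where "Q = map_mat hd_of_real P"
  define R where "R = map_mat hd_of_real (mat_inv P)"
  define D where "D = corner_mat n r C"
  define c where "c = R *\<^sub>v b"
  note P = mat_inv_works[OF assms(14,15)]
  have A: "A \<in> carrier_mat n n" using assms(1-7) by (simp add: dual_mat_carrier)
  have b: "b \<in> carrier_vec n" by fact
  have C: "C \<in> carrier_mat r r" using assms(17-21) by (simp add: hyperdual_mat_def dual_mat_carrier)
  have Q: "Q \<in> carrier_mat n n" and R: "R \<in> carrier_mat n n"
    using assms(14) P(1) by (simp_all add: Q_def R_def)
  have QR: "Q * R = 1\<^sub>m n" and RQ: "R * Q = 1\<^sub>m n"
    unfolding Q_def R_def using assms(14) P by (simp_all add: map_mat_hd_mult_eq_one)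
  have Dn: "D \<in> carrier_mat n n" unfolding D_def by (rule corner_mat_carrier) fact+
  have D: "R * A * Q = D" using assms(23) by (simp add: Q_def R_def D_def)
  \<comment> \<open>Since \<open>D\<close> is the conjugate \<open>R * A * Q\<close> and
    \<open>Q * R = 1\<close>, the matrix \<open>R\<close> intertwines \<open>A\<close> with
    \<open>D\<close>.\<close>
  have RA: "R *\<^sub>v (A *\<^sub>v x) = D *\<^sub>v (R *\<^sub>v x)" if x: "x \<in> carrier_vec n" for x
  proof -
    have "D * R = R * A * (Q * R)" unfolding D[symmetric] using A Q R by (simp add: assoc_mult_mat[of _ n n _ n _ n])
    then have "D * R = R * A" using A R by (simp add: QR)
    then show ?thesis
      using assoc_mult_mat_vec[OF R A x] assoc_mult_mat_vec[OF Dn R x] by simp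
  qed
  have QRv: "Q *\<^sub>v (R *\<^sub>v x) = x" and RQv: "R *\<^sub>v (Q *\<^sub>v x) = x" if "x \<in> carrier_vec n" for x
    using that Q R by (simp_all add: assoc_mult_mat_vec[of _ n n _ n, symmetric] QR RQ)
  have Rinj: "R *\<^sub>v x = R *\<^sub>v y \<longleftrightarrow> x = y" if "x \<in> carrier_vec n" "y \<in> carrier_vec n" for x y
    using that QRv by metis
  have car [simp]: "A *\<^sub>v x \<in> carrier_vec n" "Q *\<^sub>v x \<in> carrier_vec n" "R *\<^sub>v x \<in> carrier_vec n"
    if "x \<in> carrier_vec n" for x
    using that A Q R by (simp_all add: mult_mat_vec_carrier[of _ n n])
  \<comment> \<open>\<open>R\<close> is a bijection of the vectors of length \<open>n\<close> with
    inverse \<open>Q\<close>, so a quantifier over all vectors may range over the new coordinates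
    instead.\<close>
  have all_coords: "(\<forall>z\<in>carrier_vec n. Z (R *\<^sub>v z)) \<longleftrightarrow> (\<forall>z\<in>carrier_vec n. Z z)" for Z
    using RQv car by metis
  have c: "c \<in> carrier_vec n" using b by (simp add: c_def)

  from \<open>invertible_mat C\<close> C obtain B where
    B: "B \<in> carrier_mat r r" "C * B = 1\<^sub>m r" "B * C = 1\<^sub>m r" by (rule invertible_matE)
  define E where "E = corner_mat n r B"
  interpret corner_inverse_pair hd_weight n r D E
  proof
    show "E \<in> carrier_mat n n" unfolding E_def by (rule corner_mat_carrier) fact+
    show "D * E = coord_proj n r" "E * D = coord_proj n r"
      "coord_proj n r * D = D" "D * coord_proj n r = D"
      "coord_proj n r * E = E" "E * coord_proj n r = E"
      using C B \<open>r \<le> n\<close> by (simp_all add: D_def E_def corner_mat_mult corner_mat_one[symmetric])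
  qed fact

  have pnorm: "pnorm P x = sqrt (hd.vec_weight (R *\<^sub>v x))" if "x \<in> carrier_vec n" for x
    using pnorm_eq_vec_weight[OF P(1) that] by (simp add: R_def)
  have residual: "pnorm P (A *\<^sub>v x - b) = sqrt (hd.vec_weight (D *\<^sub>v (R *\<^sub>v x) - c))"
    if x: "x \<in> carrier_vec n" for x
    using x b R by (simp add: pnorm mult_minus_distrib_mat_vec[of _ n n] RA c_def)
  have A2: "A ^\<^sub>m 2 *\<^sub>v x = A *\<^sub>v (A *\<^sub>v x)" if "x \<in> carrier_vec n" for x
    using that A by (simp add: numeral_2_eq_2 assoc_mult_mat_vec[of _ n n _ n])
  have normal: "A ^\<^sub>m 2 *\<^sub>v x = A *\<^sub>v b \<longleftrightarrow> D *\<^sub>v (R *\<^sub>v x) = F *\<^sub>v c" if x: "x \<in> carrier_vec n" for x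
  proof -
    have "A ^\<^sub>m 2 *\<^sub>v x = A *\<^sub>v b \<longleftrightarrow> R *\<^sub>v (A *\<^sub>v (A *\<^sub>v x)) = R *\<^sub>v (A *\<^sub>v b)"
      using x b by (simp add: A2 Rinj)
    also have "\<dots> \<longleftrightarrow> D *\<^sub>v (R *\<^sub>v x) = F *\<^sub>v c"
      using x b c by (simp add: RA c_def[symmetric] normal_equation_iff)
    finally show ?thesis .
  qed

  have least_squares: "is_pnorm_least_squares P A b x \<longleftrightarrow> A ^\<^sub>m 2 *\<^sub>v x = A *\<^sub>v b"
    if x: "x \<in> carrier_vec n" for x
  proof -
    have "is_pnorm_least_squares P A b x \<longleftrightarrow>
        (\<forall>z\<in>carrier_vec n. hd.vec_weight (D *\<^sub>v (R *\<^sub>v x) - c) \<le> hd.vec_weight (D *\<^sub>v (R *\<^sub>v z) - c))"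
      using x A by (simp add: is_pnorm_least_squares_def residual)
    also have "\<dots> \<longleftrightarrow>
        (\<forall>z\<in>carrier_vec n. hd.vec_weight (D *\<^sub>v (R *\<^sub>v x) - c) \<le> hd.vec_weight (D *\<^sub>v z - c))"
      by (rule all_coords[of "\<lambda>z. hd.vec_weight (D *\<^sub>v (R *\<^sub>v x) - c) \<le> hd.vec_weight (D *\<^sub>v z - c)"])
    also have "\<dots> \<longleftrightarrow> A ^\<^sub>m 2 *\<^sub>v x = A *\<^sub>v b" using x c by (simp add: least_squares_iff normal)
    finally show ?thesis .
  qed

  define S where "S = {y \<in> carrier_vec n. A ^\<^sub>m 2 *\<^sub>v y = A *\<^sub>v b}"
  have minimal: "is_minimal_pnorm P S x \<longleftrightarrow> R *\<^sub>v x = E *\<^sub>v c" if x: "x \<in> carrier_vec n" for x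
  proof -
    have "is_minimal_pnorm P S x \<longleftrightarrow> D *\<^sub>v (R *\<^sub>v x) = F *\<^sub>v c \<and>
      (\<forall>z\<in>carrier_vec n. D *\<^sub>v (R *\<^sub>v z) = F *\<^sub>v c \<longrightarrow> hd.vec_weight (R *\<^sub>v x) \<le> hd.vec_weight (R *\<^sub>v z))"
      using x by (auto simp: is_minimal_pnorm_def S_def normal pnorm)
    also have "\<dots> \<longleftrightarrow> D *\<^sub>v (R *\<^sub>v x) = F *\<^sub>v c \<and>
      (\<forall>z\<in>carrier_vec n. D *\<^sub>v z = F *\<^sub>v c \<longrightarrow> hd.vec_weight (R *\<^sub>v x) \<le> hd.vec_weight z)"
      using all_coords[of "\<lambda>z. D *\<^sub>v z = F *\<^sub>v c \<longrightarrow> hd.vec_weight (R *\<^sub>v x) \<le> hd.vec_weight z"] by simp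
    also have "\<dots> \<longleftrightarrow> R *\<^sub>v x = E *\<^sub>v c" using x c by (simp add: minimal_solution_iff)
    finally show ?thesis .
  qed

  define G where "G = A\<^sup>#"
  have "is_group_inverse A G" unfolding G_def by (rule group_inverse_works) fact
  then have G: "G \<in> carrier_mat n n" and AGA: "A * G * A = A" and GAG: "G * A * G = G"
    and AG: "A * G = G * A"
    using A by (auto simp: is_group_inverse_def)
  have Gb: "G *\<^sub>v b \<in> carrier_vec n" "G *\<^sub>v (G *\<^sub>v b) \<in> carrier_vec n"
    using G b by (auto simp: mult_mat_vec_carrier[of _ n n])
  \<comment> \<open>Commutation of \<open>A\<close> and \<open>G\<close> turns
    \<open>A * A * G\<close> into \<open>A * G * A = A\<close>, so \<open>G *\<^sub>v b\<close>
    solves the normal equation.\<close>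
  have "A *\<^sub>v (A *\<^sub>v (G *\<^sub>v b)) = A * (A * G) *\<^sub>v b"
    using A G b by (simp add: assoc_mult_mat_vec[of _ n n _ n])
  also have "A * (A * G) = A * G * A" using assoc_mult_mat[OF A G A] AG by simp
  also note AGA
  finally have "A ^\<^sub>m 2 *\<^sub>v (G *\<^sub>v b) = A *\<^sub>v b" using Gb by (simp add: A2)
  then have "F *\<^sub>v (R *\<^sub>v (G *\<^sub>v b)) = E *\<^sub>v c"
    using Gb c normal projected_eq_iff by simp
  \<comment> \<open>From \<open>G = G * A * G = A * G * G\<close>, the vector lies in the range of
    \<open>A\<close>. Its image under \<open>R\<close> then lies in the range of \<open>D\<close>,
    which \<open>F\<close> fixes; this singles it out among the solutions.\<close>
  moreover have "G *\<^sub>v b = A *\<^sub>v (G *\<^sub>v (G *\<^sub>v b))"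
  proof -
    have "G *\<^sub>v b = (A * G * G) *\<^sub>v b" using GAG by (simp add: AG)
    then show ?thesis using A G b by (simp add: assoc_mult_mat_vec[of _ n n _ n])
  qed
  then have "F *\<^sub>v (R *\<^sub>v (G *\<^sub>v b)) = R *\<^sub>v (G *\<^sub>v b)"
    using Gb by (metis RA car(3) vec_products(3))
  ultimately have "R *\<^sub>v (G *\<^sub>v b) = E *\<^sub>v c" by simp
  \<comment> \<open>Here \<open>x\<close> is arbitrary: either side of the equivalence already
    forces it to have length \<open>n\<close>.\<close>
  then have "is_minimal_pnorm P S x \<longleftrightarrow> x = G *\<^sub>v b" for x
    using minimal Rinj Gb(1) by (metis (no_types, lifting) S_def is_minimal_pnorm_def mem_Collect_eq)
  with least_squares show ?thesis by (simp add: S_def G_def)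
qed

end
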